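(* Let $(Q,* )$ and $(Q',\cdot)$ be automorphic loops and let $f:(Q,* )\to(Q',\cdot)$ be a half-isomorphism. If $(Q',\cdot)$ satisfies condition (C), i.e. for all $a,b\in Q'$ one has $a\cdot(a\cdot b)=(b\cdot a)\cdot a$ if and only if $a\cdot b=b\cdot a$, then $f$ is trivial, i.e. $f$ is either an isomorphism or an anti-isomorphism.
   Context: A loop is a set $L$ with a binary operation such that for all $a,b\in L$ the equations $ax=b$ and $ya=b$ have unique solutions $x,y$, and there is a two-sided identity $1$. For $a\in L$ let $R_a:x\mapsto xa$ and $L_a:x\mapsto ax$. The multiplication group $\mathrm{Mlt}(L)$ is the permutation group generated by all $R_a,L_a$, and the inner mapping group is the stabilizer of $1$ in $\mathrm{Mlt}(L)$. A loop is automorphic if every inner mapping is an automorphism. A half-isomorphism between loops $(L,* )$ and $(L',\cdot)$ is a bijection $f:L\to L'$ with $f(x*y)\in\{f(x)\cdot f(y),\,f(y)\cdot f(x)\}$ for all $x,y\in L$. An anti-isomorphism is a bijection with $f(x*y)=f(y)\cdot f(x)$ for all $x,y$. A half-isomorphism is trivial if it is an isomorphism or an anti-isomorphism. *)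

theory Defs
  imports Main
begin

definition loop :: "'a set \<Rightarrow> ('a \<Rightarrow> 'a \<Rightarrow> 'a) \<Rightarrow> 'a \<Rightarrow> bool" where
  "loop Q m e \<longleftrightarrow>
     (\<forall>x\<in>Q. \<forall>y\<in>Q. m x y \<in> Q) \<and> e \<in> Q \<and>
     (\<forall>x\<in>Q. m e x = x \<and> m x e = x) \<and>
     (\<forall>a\<in>Q. \<forall>b\<in>Q. \<exists>!x. x \<in> Q \<and> m a x = b) \<and>
     (\<forall>a\<in>Q. \<forall>b\<in>Q. \<exists>!y. y \<in> Q \<and> m y a = b)"

definition rtrans :: "'a set \<Rightarrow> ('a \<Rightarrow> 'a \<Rightarrow> 'a) \<Rightarrow> 'a \<Rightarrow> 'a \<Rightarrow> 'a" where
  "rtrans Q m a = (\<lambda>x. if x \<in> Q then m x a else x)"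

definition ltrans :: "'a set \<Rightarrow> ('a \<Rightarrow> 'a \<Rightarrow> 'a) \<Rightarrow> 'a \<Rightarrow> 'a \<Rightarrow> 'a" where
  "ltrans Q m a = (\<lambda>x. if x \<in> Q then m a x else x)"

definition rtrans_inv :: "'a set \<Rightarrow> ('a \<Rightarrow> 'a \<Rightarrow> 'a) \<Rightarrow> 'a \<Rightarrow> 'a \<Rightarrow> 'a" where
  "rtrans_inv Q m a = (\<lambda>x. if x \<in> Q then (THE y. y \<in> Q \<and> m y a = x) else x)"

definition ltrans_inv :: "'a set \<Rightarrow> ('a \<Rightarrow> 'a \<Rightarrow> 'a) \<Rightarrow> 'a \<Rightarrow> 'a \<Rightarrow> 'a" where
  "ltrans_inv Q m a = (\<lambda>x. if x \<in> Q then (THE y. y \<in> Q \<and> m a y = x) else x)"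

inductive_set mlt :: "'a set \<Rightarrow> ('a \<Rightarrow> 'a \<Rightarrow> 'a) \<Rightarrow> ('a \<Rightarrow> 'a) set"
  for Q m where
  mlt_id: "id \<in> mlt Q m"
| mlt_R: "a \<in> Q \<Longrightarrow> g \<in> mlt Q m \<Longrightarrow> rtrans Q m a \<circ> g \<in> mlt Q m"
| mlt_L: "a \<in> Q \<Longrightarrow> g \<in> mlt Q m \<Longrightarrow> ltrans Q m a \<circ> g \<in> mlt Q m"
| mlt_Rinv: "a \<in> Q \<Longrightarrow> g \<in> mlt Q m \<Longrightarrow> rtrans_inv Q m a \<circ> g \<in> mlt Q m"
| mlt_Linv: "a \<in> Q \<Longrightarrow> g \<in> mlt Q m \<Longrightarrow> ltrans_inv Q m a \<circ> g \<in> mlt Q m"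

definition inn :: "'a set \<Rightarrow> ('a \<Rightarrow> 'a \<Rightarrow> 'a) \<Rightarrow> 'a \<Rightarrow> ('a \<Rightarrow> 'a) set" where
  "inn Q m e = {g \<in> mlt Q m. g e = e}"

definition automorphic_loop :: "'a set \<Rightarrow> ('a \<Rightarrow> 'a \<Rightarrow> 'a) \<Rightarrow> 'a \<Rightarrow> bool" where
  "automorphic_loop Q m e \<longleftrightarrow> loop Q m e \<and>
     (\<forall>g\<in>inn Q m e. \<forall>x\<in>Q. \<forall>y\<in>Q. g (m x y) = m (g x) (g y))"

definition half_iso :: "'a set \<Rightarrow> ('a \<Rightarrow> 'a \<Rightarrow> 'a) \<Rightarrow> 'b set \<Rightarrow> ('b \<Rightarrow> 'b \<Rightarrow> 'b) \<Rightarrow> ('a \<Rightarrow> 'b) \<Rightarrow> bool" where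
  "half_iso Q m Q' m' f \<longleftrightarrow> bij_betw f Q Q' \<and>
     (\<forall>x\<in>Q. \<forall>y\<in>Q. f (m x y) = m' (f x) (f y) \<or> f (m x y) = m' (f y) (f x))"

definition loop_iso :: "'a set \<Rightarrow> ('a \<Rightarrow> 'a \<Rightarrow> 'a) \<Rightarrow> 'b set \<Rightarrow> ('b \<Rightarrow> 'b \<Rightarrow> 'b) \<Rightarrow> ('a \<Rightarrow> 'b) \<Rightarrow> bool" where
  "loop_iso Q m Q' m' f \<longleftrightarrow> bij_betw f Q Q' \<and> (\<forall>x\<in>Q. \<forall>y\<in>Q. f (m x y) = m' (f x) (f y))"

definition loop_anti_iso :: "'a set \<Rightarrow> ('a \<Rightarrow> 'a \<Rightarrow> 'a) \<Rightarrow> 'b set \<Rightarrow> ('b \<Rightarrow> 'b \<Rightarrow> 'b) \<Rightarrow> ('a \<Rightarrow> 'b) \<Rightarrow> bool" where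
  "loop_anti_iso Q m Q' m' f \<longleftrightarrow> bij_betw f Q Q' \<and> (\<forall>x\<in>Q. \<forall>y\<in>Q. f (m x y) = m' (f y) (f x))"

definition condC :: "'b set \<Rightarrow> ('b \<Rightarrow> 'b \<Rightarrow> 'b) \<Rightarrow> bool" where
  "condC Q m \<longleftrightarrow> (\<forall>a\<in>Q. \<forall>b\<in>Q. m a (m a b) = m (m b a) a \<longleftrightarrow> m a b = m b a)"

end

theory Submission
  imports Defs
begin

text \<open>
  Write \<open>a = f x\<close>, \<open>u = f y\<close> and let \<open>T\<^sub>a\<close> be the inner mapping with \<open>a \<cdot> T\<^sub>a v = v \<cdot> a\<close>.
  In an automorphic loop the inverse is an antiautomorphism, hence the element \<open>w\<close> with
  \<open>w a\<inverse> = a u\<close> (in a group, \<open>w = a u a\<close>) also satisfies \<open>a\<inverse> w = u a\<close>, \<open>w u = (a u) (a u)\<close>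
  and \<open>u w = (u a) (u a)\<close>. These identities force \<open>f\<close> to preserve this element whenever \<open>x\<close>
  and \<open>y\<close> commute, and comparing \<open>f (x y)\<close> with \<open>f (x\<inverse> y)\<close> and \<open>f (x\<inverse> y\<inverse>)\<close> shows that then
  \<open>a\<close> and \<open>u\<close> commute, too. So for noncommuting \<open>x\<close>, \<open>y\<close> exactly one of \<open>f (x y) = a u\<close> and
  \<open>f (x y) = u a\<close> holds, and accordingly \<open>f (T\<^sub>x y)\<close> is \<open>T\<^sub>a u\<close> or \<open>T\<^sub>a\<inverse> u\<close>. If both cases
  occurred for the same \<open>x\<close>, with witnesses \<open>y\<close> and \<open>z\<close>, then applying the automorphism \<open>T\<^sub>x\<close>
  to \<open>y z\<close>, \<open>z y\<close> and to the same products with \<open>y\<inverse>\<close> for \<open>y\<close> would yield an element fixed by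
  some \<open>T\<^sub>c\<^sup>2\<close> but not by \<open>T\<^sub>c\<close>, which condition (C) excludes. Finally, centralizers are subloops,
  which prevents the two cases from occurring for different \<open>x\<close>.
\<close>

section \<open>Divisions and inner mappings of an automorphic loop\<close>

locale aloop =
  fixes Q :: "'a set" and m :: "'a \<Rightarrow> 'a \<Rightarrow> 'a" (infixl "\<cdot>" 70) and e :: 'a
  assumes automorphic: "automorphic_loop Q (\<cdot>) e"
begin

lemma loop: "loop Q (\<cdot>) e"
  using automorphic by (simp add: automorphic_loop_def)

lemma closed [simp, intro]: "x \<in> Q \<Longrightarrow> y \<in> Q \<Longrightarrow> x \<cdot> y \<in> Q"
  and e_closed [simp, intro]: "e \<in> Q"
  and e_left [simp]: "x \<in> Q \<Longrightarrow> e \<cdot> x = x"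
  and e_right [simp]: "x \<in> Q \<Longrightarrow> x \<cdot> e = x"
  and ex1_left: "a \<in> Q \<Longrightarrow> b \<in> Q \<Longrightarrow> \<exists>!x. x \<in> Q \<and> a \<cdot> x = b"
  and ex1_right: "a \<in> Q \<Longrightarrow> b \<in> Q \<Longrightarrow> \<exists>!y. y \<in> Q \<and> y \<cdot> a = b"
  using loop unfolding loop_def by auto

lemma left_cancel [simp]: "a \<in> Q \<Longrightarrow> x \<in> Q \<Longrightarrow> y \<in> Q \<Longrightarrow> a \<cdot> x = a \<cdot> y \<longleftrightarrow> x = y"
  using ex1_left closed by metis

lemma right_cancel [simp]: "a \<in> Q \<Longrightarrow> x \<in> Q \<Longrightarrow> y \<in> Q \<Longrightarrow> x \<cdot> a = y \<cdot> a \<longleftrightarrow> x = y"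
  using ex1_right closed by metis

definition ldiv :: "'a \<Rightarrow> 'a \<Rightarrow> 'a" where
  "ldiv a b = ltrans_inv Q (\<cdot>) a b"

definition rdiv :: "'a \<Rightarrow> 'a \<Rightarrow> 'a" where
  "rdiv b a = rtrans_inv Q (\<cdot>) a b"

lemma ldiv:
  assumes "a \<in> Q" "b \<in> Q"
  shows "ldiv a b \<in> Q" "a \<cdot> ldiv a b = b"
  using theI'[OF ex1_left[OF assms]] assms by (simp_all add: ldiv_def ltrans_inv_def)

lemma rdiv:
  assumes "a \<in> Q" "b \<in> Q"
  shows "rdiv b a \<in> Q" "rdiv b a \<cdot> a = b"
  using theI'[OF ex1_right[OF assms]] assms by (simp_all add: rdiv_def rtrans_inv_def)

lemma mlt_closed:
  assumes "g \<in> mlt Q (\<cdot>)" "x \<in> Q"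
  shows "g x \<in> Q"
  using assms
  by (induction rule: mlt.induct)
    (auto simp: rtrans_def ltrans_def ldiv[unfolded ldiv_def] rdiv[unfolded rdiv_def])

lemma inn_closed: "g \<in> inn Q (\<cdot>) e \<Longrightarrow> x \<in> Q \<Longrightarrow> g x \<in> Q"
  using mlt_closed by (auto simp: inn_def)

lemma inn_mult: "g \<in> inn Q (\<cdot>) e \<Longrightarrow> x \<in> Q \<Longrightarrow> y \<in> Q \<Longrightarrow> g (x \<cdot> y) = g x \<cdot> g y"
  using automorphic by (simp add: automorphic_loop_def)

lemma inn_e: "g \<in> inn Q (\<cdot>) e \<Longrightarrow> g e = e"
  by (simp add: inn_def)

definition T :: "'a \<Rightarrow> 'a \<Rightarrow> 'a" where
  "T a x = ldiv a (x \<cdot> a)"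

lemma T_closed [simp, intro]: "a \<in> Q \<Longrightarrow> x \<in> Q \<Longrightarrow> T a x \<in> Q"
  and mult_T: "a \<in> Q \<Longrightarrow> x \<in> Q \<Longrightarrow> a \<cdot> T a x = x \<cdot> a"
  using ldiv by (auto simp: T_def)

lemma T_eq_iff: "a \<in> Q \<Longrightarrow> x \<in> Q \<Longrightarrow> y \<in> Q \<Longrightarrow> T a x = y \<longleftrightarrow> a \<cdot> y = x \<cdot> a"
  using mult_T left_cancel T_closed by metis

lemma T_inj: "a \<in> Q \<Longrightarrow> x \<in> Q \<Longrightarrow> y \<in> Q \<Longrightarrow> T a x = T a y \<longleftrightarrow> x = y"
  using mult_T right_cancel by metis

text \<open>On \<open>Q\<close>, \<open>T a\<close> agrees with L_a^{-1} R_a, which lies in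
  \<open>mlt\<close> and fixes \<open>e\<close>, so it is an inner mapping. In a group it is
  conjugation by \<open>a\<close>.\<close>

lemma T_mult:
  assumes "a \<in> Q" "x \<in> Q" "y \<in> Q"
  shows "T a (x \<cdot> y) = T a x \<cdot> T a y"
proof -
  let ?g = "ltrans_inv Q (\<cdot>) a \<circ> (rtrans Q (\<cdot>) a \<circ> id)"
  have g: "?g z = T a z" if "z \<in> Q" for z
    using that by (simp add: T_def ldiv_def rtrans_def)
  have mlt: "?g \<in> mlt Q (\<cdot>)"
    using assms by (intro mlt.intros)
  have "T a e = e"
    using assms by (simp add: T_eq_iff)
  then have "?g \<in> inn Q (\<cdot>) e"
    using assms g[of e] mlt by (simp add: inn_def)
  from inn_mult[OF this assms(2,3)] show ?thesis
    using assms g by simp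
qed

text \<open>The mapping is L_{xy}^{-1} L_x L_y. Describing it by an equation without division lets
  later proofs choose \<open>z\<close> and cancel.\<close>

lemma inner_left_exists:
  assumes "x \<in> Q" "y \<in> Q"
  obtains g where "g \<in> inn Q (\<cdot>) e" "\<And>z. z \<in> Q \<Longrightarrow> (x \<cdot> y) \<cdot> g z = x \<cdot> (y \<cdot> z)"
proof -
  let ?g = "ltrans_inv Q (\<cdot>) (x \<cdot> y) \<circ> (ltrans Q (\<cdot>) x \<circ> (ltrans Q (\<cdot>) y \<circ> id))"
  have g: "?g z = ldiv (x \<cdot> y) (x \<cdot> (y \<cdot> z))" if "z \<in> Q" for z
    using that assms by (simp add: ltrans_def ldiv_def)
  have mlt: "?g \<in> mlt Q (\<cdot>)"
    using assms by (intro mlt.intros closed)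
  have "?g e = e"
    using assms g[of e] ldiv[of "x \<cdot> y" "x \<cdot> y"] left_cancel[of "x \<cdot> y" _ e] by simp
  then have "?g \<in> inn Q (\<cdot>) e"
    using mlt by (simp add: inn_def)
  then show thesis
    using that g ldiv assms by (metis closed)
qed

lemma inner_right_exists:
  assumes "x \<in> Q" "y \<in> Q"
  obtains g where "g \<in> inn Q (\<cdot>) e" "\<And>z. z \<in> Q \<Longrightarrow> g z \<cdot> (x \<cdot> y) = (z \<cdot> x) \<cdot> y"
proof -
  let ?g = "rtrans_inv Q (\<cdot>) (x \<cdot> y) \<circ> (rtrans Q (\<cdot>) y \<circ> (rtrans Q (\<cdot>) x \<circ> id))"
  have g: "?g z = rdiv ((z \<cdot> x) \<cdot> y) (x \<cdot> y)" if "z \<in> Q" for z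
    using that assms by (simp add: rtrans_def rdiv_def)
  have mlt: "?g \<in> mlt Q (\<cdot>)"
    using assms by (intro mlt.intros closed)
  have "?g e = e"
    using assms g[of e] rdiv[of "x \<cdot> y" "x \<cdot> y"] right_cancel[of "x \<cdot> y" _ e] by simp
  then have "?g \<in> inn Q (\<cdot>) e"
    using mlt by (simp add: inn_def)
  then show thesis
    using that g rdiv assms by (metis closed)
qed

lemma T_self: "a \<in> Q \<Longrightarrow> T a a = a"
  by (simp add: T_eq_iff)

text \<open>\<open>T x\<close> fixes \<open>x\<close>, so
  \<open>T x (x \<cdot> y) = x \<cdot> T x y = y \<cdot> x\<close>; multiplying by \<open>x\<close>
  on the left gives the law.\<close>

lemma flexible:
  assumes "x \<in> Q" "y \<in> Q"
  shows "x \<cdot> (y \<cdot> x) = (x \<cdot> y) \<cdot> x"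
  using T_mult[of x x y] mult_T[of x "x \<cdot> y"] mult_T[of x y] assms by (simp add: T_self)

section \<open>Two-sided inverses and their antiautomorphic property\<close>

definition inv :: "'a \<Rightarrow> 'a" where
  "inv a = ldiv a e"

lemma inv_closed [simp, intro]: "a \<in> Q \<Longrightarrow> inv a \<in> Q"
  and inv_right [simp]: "a \<in> Q \<Longrightarrow> a \<cdot> inv a = e"
  using ldiv by (auto simp: inv_def)

lemma T_e: "a \<in> Q \<Longrightarrow> T a e = e"
  by (simp add: T_eq_iff)

lemma T_self_inv:
  assumes "a \<in> Q"
  shows "T a (inv a) = inv a"
proof -
  have "a \<cdot> T a (inv a) = a \<cdot> inv a"
    using T_mult[of a a "inv a"] assms by (simp add: T_self T_e)
  then show ?thesis
    using assms by (simp del: inv_right)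
qed

lemma inv_left [simp]: "a \<in> Q \<Longrightarrow> inv a \<cdot> a = e"
  using T_self_inv[of a] mult_T[of a "inv a"] by simp

lemma inv_unique: "a \<in> Q \<Longrightarrow> b \<in> Q \<Longrightarrow> a \<cdot> b = e \<Longrightarrow> inv a = b"
  using left_cancel[of a "inv a" b] by simp

lemma inv_inv [simp]: "a \<in> Q \<Longrightarrow> inv (inv a) = a"
  by (rule inv_unique) auto

lemma inv_eq_iff: "a \<in> Q \<Longrightarrow> b \<in> Q \<Longrightarrow> inv a = inv b \<longleftrightarrow> a = b"
  using inv_inv by metis

lemma inn_inv: "g \<in> inn Q (\<cdot>) e \<Longrightarrow> x \<in> Q \<Longrightarrow> g (inv x) = inv (g x)"
  using inn_mult[of g x "inv x"] inv_unique[of "g x" "g (inv x)"]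
  by (simp add: inn_closed inn_e)

lemma T_inv: "a \<in> Q \<Longrightarrow> x \<in> Q \<Longrightarrow> T a (inv x) = inv (T a x)"
  using T_mult[of a x "inv x"] inv_unique[of "T a x" "T a (inv x)"]
  by (simp add: T_e)

text \<open>The inner mapping \<open>z \<mapsto> a \<cdot> (inv a \<cdot> z)\<close> fixes
  \<open>a\<close>, hence commutes with left multiplication by \<open>a\<close>; then cancel
  \<open>a\<close>.\<close>

lemma left_inv_commute:
  assumes "a \<in> Q" "z \<in> Q"
  shows "inv a \<cdot> (a \<cdot> z) = a \<cdot> (inv a \<cdot> z)"
proof -
  obtain g where g: "g \<in> inn Q (\<cdot>) e" "\<And>z. z \<in> Q \<Longrightarrow> (a \<cdot> inv a) \<cdot> g z = a \<cdot> (inv a \<cdot> z)"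
    using inner_left_exists[of a "inv a"] assms by blast
  then have g_eq: "g z = a \<cdot> (inv a \<cdot> z)" if "z \<in> Q" for z
    using g(2)[OF that] that assms inn_closed[OF g(1), of z] by simp
  have "g (a \<cdot> z) = a \<cdot> g z"
    using inn_mult[OF g(1), of a z] g_eq[of a] assms by simp
  then show ?thesis
    using assms g_eq by simp
qed

lemma left_inv_right_commute:
  assumes "a \<in> Q" "z \<in> Q"
  shows "(inv a \<cdot> z) \<cdot> a = inv a \<cdot> (z \<cdot> a)"
proof -
  have "(inv a \<cdot> z) \<cdot> a = a \<cdot> (inv a \<cdot> T a z)"
    using mult_T[of a "inv a \<cdot> z"] T_mult[of a "inv a" z] T_self_inv[of a] assms by simp
  also have "\<dots> = inv a \<cdot> (z \<cdot> a)"
    using left_inv_commute[of a "T a z"] mult_T[of a z] assms by simp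
  finally show ?thesis .
qed

text \<open>One inner mapping \<open>g\<close>, built from \<open>x = s \<cdot> w\<close> and
  \<open>y\<close> with \<open>x \<cdot> y = s\<close>, does everything: it fixes \<open>x\<close>
  by flexibility and sends \<open>y\<close> to \<open>inv w\<close>. The factorization
  \<open>inv x = y \<cdot> z\<close> is then mapped to the claim.\<close>

theorem inv_mult:
  assumes "s \<in> Q" "w \<in> Q"
  shows "inv (s \<cdot> w) = inv w \<cdot> inv s"
proof -
  define x where "x = s \<cdot> w"
  define y where "y = ldiv x s"
  have Q: "x \<in> Q" "y \<in> Q" and xy: "x \<cdot> y = s"
    using assms ldiv by (auto simp: x_def y_def)
  obtain g where g: "g \<in> inn Q (\<cdot>) e" and s_g: "\<And>z. z \<in> Q \<Longrightarrow> s \<cdot> g z = x \<cdot> (y \<cdot> z)"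
    using inner_left_exists[OF Q] xy by metis
  have "s \<cdot> g x = s \<cdot> x"
    using s_g[of x] flexible[of x y] Q xy by simp
  then have gx: "g x = x"
    using assms Q g inn_closed by simp
  have "s \<cdot> g (inv y) = s \<cdot> w"
    using s_g[of "inv y"] Q by (simp add: x_def)
  then have "inv (g y) = w"
    using assms Q g inn_closed inn_inv by simp
  then have gy: "g y = inv w"
    using Q g inn_closed inv_inv by metis
  define z where "z = ldiv y (inv x)"
  have z: "z \<in> Q" "y \<cdot> z = inv x"
    using Q ldiv by (auto simp: z_def)
  \<comment> \<open>By the choice of \<open>z\<close>,
    \<open>x \<cdot> (y \<cdot> z) = x \<cdot> inv x\<close>.\<close>
  have "s \<cdot> g z = e"
    using s_g[of z] z Q by simp
  then have "g z = inv s"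
    using inv_unique[of s "g z"] assms z g inn_closed by simp
  moreover have "g y \<cdot> g z = inv x"
    using inn_mult[OF g, of y z] inn_inv[OF g, of x] Q z gx by simp
  ultimately show ?thesis
    using gy by (simp add: x_def)
qed

text \<open>The inner mapping \<open>z \<mapsto> inv a \<cdot> (a \<cdot> z)\<close> commutes with
  \<open>inv\<close>, while \<open>inv\<close> reverses products: evaluating at \<open>inv z\<close>
  and inverting moves both factors to the right.\<close>

lemma left_right_inv:
  assumes "a \<in> Q" "z \<in> Q"
  shows "inv a \<cdot> (a \<cdot> z) = (z \<cdot> inv a) \<cdot> a"
proof -
  obtain g where g: "g \<in> inn Q (\<cdot>) e" "\<And>z. z \<in> Q \<Longrightarrow> (inv a \<cdot> a) \<cdot> g z = inv a \<cdot> (a \<cdot> z)"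
    using inner_left_exists[of "inv a" a] assms by blast
  then have g_eq: "g z = inv a \<cdot> (a \<cdot> z)" if "z \<in> Q" for z
    using g(2)[OF that] that assms inn_closed[OF g(1), of z] by simp
  have "inv a \<cdot> (a \<cdot> z) = inv (g (inv z))"
    using inn_inv[OF g(1), of "inv z"] g_eq[of z] assms by simp
  also have "\<dots> = (z \<cdot> inv a) \<cdot> a"
    using g_eq[of "inv z"] assms by (simp add: inv_mult)
  finally show ?thesis .
qed

lemma left_right_inv':
  assumes "a \<in> Q" "z \<in> Q"
  shows "inv a \<cdot> (a \<cdot> z) = (z \<cdot> a) \<cdot> inv a"
  using left_right_inv[of "inv a" z] left_inv_commute[of a z] assms by simp

lemma right_inv_left_commute:
  assumes "a \<in> Q" "z \<in> Q"
  shows "(a \<cdot> z) \<cdot> inv a = a \<cdot> (z \<cdot> inv a)"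
  using left_inv_right_commute[of "inv a" z] assms by simp

section \<open>The element that replaces the group product a u a\<close>

text \<open>In a group, the hypothesis on \<open>w\<close> says \<open>w = a u a\<close>.\<close>

lemma sandwich_left:
  assumes "a \<in> Q" "u \<in> Q" "w \<in> Q" "w \<cdot> inv a = a \<cdot> u"
  shows "inv a \<cdot> w = u \<cdot> a"
proof -
  have "(inv a \<cdot> w) \<cdot> inv a = (u \<cdot> a) \<cdot> inv a"
    using flexible[of "inv a" w] left_right_inv'[of a u] assms by simp
  then show ?thesis
    using assms by simp
qed

lemma sandwich_square_right:
  assumes "a \<in> Q" "u \<in> Q" "w \<in> Q" "w \<cdot> inv a = a \<cdot> u"
  shows "w \<cdot> u = (a \<cdot> u) \<cdot> (a \<cdot> u)"
proof -
  define z where "z = ldiv (inv a) u"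
  have z: "z \<in> Q" "inv a \<cdot> z = u"
    using assms ldiv by (auto simp: z_def)
  have "inv a \<cdot> (z \<cdot> a) = inv a \<cdot> w"
    using left_inv_right_commute[of a z] sandwich_left[OF assms] z assms by simp
  then have w: "w = z \<cdot> a"
    using z assms by simp
  obtain g where g: "g \<in> inn Q (\<cdot>) e" and g_eq: "\<And>z. z \<in> Q \<Longrightarrow> g z \<cdot> (a \<cdot> u) = (z \<cdot> a) \<cdot> u"
    using inner_right_exists[of a u] assms by blast
  \<comment> \<open>Hence \<open>(inv z \<cdot> a) \<cdot> u = e\<close>, so \<open>g\<close> sends
    \<open>inv z\<close> to the inverse of \<open>a \<cdot> u\<close>, that is,
    \<open>g z = a \<cdot> u\<close>. The equation for \<open>g z\<close> is then the claim.\<close>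
  have "inv z \<cdot> a = inv u"
    using inv_mult[of "inv a" z] z assms by simp
  then have "inv (g z) \<cdot> (a \<cdot> u) = e"
    using g_eq[of "inv z"] inn_inv[OF g, of z] z assms by simp
  then have "a \<cdot> u = g z"
    using inv_unique[of "inv (g z)" "a \<cdot> u"] inn_closed[OF g] z assms by simp
  then show ?thesis
    using g_eq[of z] z w by simp
qed

lemma sandwich_square_left:
  assumes "a \<in> Q" "u \<in> Q" "w \<in> Q" "w \<cdot> inv a = a \<cdot> u"
  shows "u \<cdot> w = (u \<cdot> a) \<cdot> (u \<cdot> a)"
proof -
  define z where "z = rdiv u (inv a)"
  have z: "z \<in> Q" "z \<cdot> inv a = u"
    using assms rdiv by (auto simp: z_def)
  have "(a \<cdot> z) \<cdot> inv a = w \<cdot> inv a"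
    using right_inv_left_commute[of a z] z assms by simp
  then have w: "w = a \<cdot> z"
    using z assms right_cancel by (metis closed inv_closed)
  obtain g where g: "g \<in> inn Q (\<cdot>) e" and g_eq: "\<And>z. z \<in> Q \<Longrightarrow> (u \<cdot> a) \<cdot> g z = u \<cdot> (a \<cdot> z)"
    using inner_left_exists[of u a] assms by blast
  have "a \<cdot> inv z = inv u"
    using inv_mult[of z "inv a"] z assms by simp
  then have "(u \<cdot> a) \<cdot> inv (g z) = e"
    using g_eq[of "inv z"] inn_inv[OF g, of z] z assms by simp
  then have "inv (u \<cdot> a) = inv (g z)"
    using inv_unique[of "u \<cdot> a" "inv (g z)"] inn_closed[OF g] z assms by simp
  then have "u \<cdot> a = g z"
    using inn_closed[OF g] z assms by (metis closed inv_inv)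
  then show ?thesis
    using g_eq[of z] z w by simp
qed

section \<open>Commuting elements and the effect of condition (C)\<close>

lemma commute_iff_T: "a \<in> Q \<Longrightarrow> x \<in> Q \<Longrightarrow> a \<cdot> x = x \<cdot> a \<longleftrightarrow> T a x = x"
  by (simp add: T_eq_iff)

lemma commute_mult:
  assumes "a \<in> Q" "x \<in> Q" "y \<in> Q" "a \<cdot> x = x \<cdot> a"
  shows "a \<cdot> (x \<cdot> y) = (x \<cdot> y) \<cdot> a \<longleftrightarrow> a \<cdot> y = y \<cdot> a"
    and "a \<cdot> (y \<cdot> x) = (y \<cdot> x) \<cdot> a \<longleftrightarrow> a \<cdot> y = y \<cdot> a"
  using assms by (simp_all add: commute_iff_T T_mult)

lemma commute_inv:
  assumes "a \<in> Q" "x \<in> Q"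
  shows "a \<cdot> inv x = inv x \<cdot> a \<longleftrightarrow> a \<cdot> x = x \<cdot> a"
  using assms by (simp add: commute_iff_T T_inv inv_eq_iff)

text \<open>By flexibility, \<open>a \<cdot> (a \<cdot> x) = a \<cdot> (T a x \<cdot> a) = (a
  \<cdot> T a x) \<cdot> a = (x \<cdot> a) \<cdot> a\<close>, to which (C) applies. All uses of (C)
  go through this lemma.\<close>

lemma T_square_fixed:
  assumes "condC Q (\<cdot>)" "a \<in> Q" "x \<in> Q" "T a (T a x) = x"
  shows "T a x = x"
proof -
  have "a \<cdot> x = T a x \<cdot> a"
    using mult_T[of a "T a x"] assms by simp
  then have "a \<cdot> (a \<cdot> x) = (x \<cdot> a) \<cdot> a"
    using flexible[of a "T a x"] mult_T[of a x] assms by simp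
  then have "a \<cdot> x = x \<cdot> a"
    using assms(1-3) unfolding condC_def by blast
  then show ?thesis
    using assms by (simp add: T_eq_iff)
qed

text \<open>The two equations say that \<open>T a\<close> interchanges \<open>x\<close> and
  \<open>y\<close>, so its square fixes \<open>x\<close>.\<close>

lemma T_swap:
  assumes "condC Q (\<cdot>)" "a \<in> Q" "x \<in> Q" "y \<in> Q" "a \<cdot> x = y \<cdot> a" "a \<cdot> y = x \<cdot> a"
  shows "x = y"
proof -
  have "T a y = x" "T a x = y"
    using assms(2-) by (simp_all add: T_eq_iff)
  then show ?thesis
    using T_square_fixed[OF assms(1-3)] by simp
qed

text \<open>This expresses that \<open>T (inv a)\<close> is the inverse of
  \<open>T a\<close>.\<close>

lemma T_inverse_element:
  assumes "a \<in> Q" "x \<in> Q" "y \<in> Q"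
  shows "inv a \<cdot> y = x \<cdot> inv a \<longleftrightarrow> a \<cdot> x = y \<cdot> a"
proof -
  have "inv a \<cdot> y = x \<cdot> inv a \<longleftrightarrow> (inv a \<cdot> y) \<cdot> a = (x \<cdot> inv a) \<cdot> a"
    using assms by simp
  also have "\<dots> \<longleftrightarrow> inv a \<cdot> (y \<cdot> a) = inv a \<cdot> (a \<cdot> x)"
    using left_inv_right_commute[of a y] left_right_inv[of a x] assms by simp
  finally show ?thesis
    using assms by auto
qed

end

section \<open>Half-isomorphisms preserve and reflect commuting\<close>

locale half_isomorphism =
  dom: aloop Q m e + cod: aloop Q' m' e'
  for Q :: "'a set" and m (infixl "\<cdot>" 70) and e
    and Q' :: "'b set" and m' (infixl "\<bullet>" 70) and e' +
  fixes f :: "'a \<Rightarrow> 'b"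
  assumes half_iso: "half_iso Q (\<cdot>) Q' (\<bullet>) f"
begin

lemma f_closed [simp, intro]: "x \<in> Q \<Longrightarrow> f x \<in> Q'"
  and f_inj [simp]: "x \<in> Q \<Longrightarrow> y \<in> Q \<Longrightarrow> f x = f y \<longleftrightarrow> x = y"
  and f_mult: "x \<in> Q \<Longrightarrow> y \<in> Q \<Longrightarrow> f (x \<cdot> y) = f x \<bullet> f y \<or> f (x \<cdot> y) = f y \<bullet> f x"
  using half_iso by (auto simp: half_iso_def bij_betw_def inj_on_def)

lemma f_e: "f e = e'"
proof -
  have "f e \<bullet> f e = f e \<bullet> e'"
    using f_mult[of e e] by simp
  then show ?thesis
    by (simp del: cod.e_right)
qed

lemma f_inv:
  assumes "x \<in> Q"
  shows "f (dom.inv x) = cod.inv (f x)"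
proof -
  have "f x \<bullet> f (dom.inv x) = e'" if "f (dom.inv x) \<bullet> f x = e'"
    using that cod.inv_unique[of "f (dom.inv x)" "f x"] assms
    by (metis f_closed dom.inv_closed cod.inv_left)
  then have "f x \<bullet> f (dom.inv x) = e'"
    using f_mult[of x "dom.inv x"] assms by (auto simp: f_e)
  then show ?thesis
    using assms cod.inv_unique by (metis f_closed dom.inv_closed)
qed

text \<open>The image of \<open>p\<close> is shown to be the sandwich element \<open>w\<close> of
  \<open>f x\<close> and \<open>f y\<close>. If not, the products \<open>dom.inv x \<cdot> p\<close>
  and \<open>p \<cdot> y\<close> are both mapped in the wrong order; applying
  \<open>cod.T (f x)\<close> then makes \<open>f x\<close> and \<open>f y\<close> commute, and the
  wrong order becomes the right one.\<close>

lemma f_sandwich: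
  assumes Q: "x \<in> Q" "y \<in> Q" "p \<in> Q"
    and comm: "x \<cdot> y = y \<cdot> x" and p: "p \<cdot> dom.inv x = x \<cdot> y"
  shows "f p \<bullet> cod.inv (f x) = f x \<bullet> f y" "cod.inv (f x) \<bullet> f p = f y \<bullet> f x"
proof -
  let ?a = "f x" and ?u = "f y" and ?q = "f p"
  have a: "?a \<in> Q'" "?u \<in> Q'" "?q \<in> Q'"
    using Q by auto
  define w where "w = cod.rdiv (?a \<bullet> ?u) (cod.inv ?a)"
  have w: "w \<in> Q'" and w1: "w \<bullet> cod.inv ?a = ?a \<bullet> ?u"
    using cod.rdiv[of "cod.inv ?a" "?a \<bullet> ?u"] a by (auto simp: w_def)
  note w2 = cod.sandwich_left[OF a(1,2) w w1]
    and w3 = cod.sandwich_square_right[OF a(1,2) w w1]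
    and w4 = cod.sandwich_square_left[OF a(1,2) w w1]
  have p': "dom.inv x \<cdot> p = x \<cdot> y"
    using dom.sandwich_left[OF Q p] comm by simp
  have pp: "p \<cdot> y = (x \<cdot> y) \<cdot> (x \<cdot> y)"
    using dom.sandwich_square_right[OF Q p] .
  have "f (x \<cdot> y) = cod.inv ?a \<bullet> ?q \<or> f (x \<cdot> y) = ?q \<bullet> cod.inv ?a"
    using f_mult[of "dom.inv x" p] Q p' by (simp add: f_inv)
  moreover have sq: "f (x \<cdot> y) \<bullet> f (x \<cdot> y) = ?q \<bullet> ?u \<or> f (x \<cdot> y) \<bullet> f (x \<cdot> y) = ?u \<bullet> ?q"
    using f_mult[of p y] f_mult[of "x \<cdot> y" "x \<cdot> y"] Q pp by auto
  have T_b: "cod.T ?a (?a \<bullet> ?u) = ?u \<bullet> ?a"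
    using cod.flexible[of ?a ?u] a by (simp add: cod.T_eq_iff)
  have T_inv: "cod.T ?a (cod.inv ?a) = cod.inv ?a"
    using cod.T_self_inv a by simp
  have T_bb: "cod.T ?a ((?a \<bullet> ?u) \<bullet> (?a \<bullet> ?u)) = (?u \<bullet> ?a) \<bullet> (?u \<bullet> ?a)"
    using cod.T_mult[of ?a "?a \<bullet> ?u" "?a \<bullet> ?u"] T_b a by simp
  have T_u: "?a \<bullet> ?u = ?u \<bullet> ?a" if "cod.T ?a ?u = ?u"
    using that a by (simp add: cod.commute_iff_T)
  have "?q = w"
  proof (cases "f (x \<cdot> y) = ?a \<bullet> ?u")
    case True
    note b = this
    show ?thesis
    proof (rule ccontr)
      assume neq: "?q \<noteq> w"
      then have q1: "cod.inv ?a \<bullet> ?q = ?a \<bullet> ?u"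
        using calculation b w1 a w cod.right_cancel[of "cod.inv ?a" ?q w] by auto
      have q2: "?u \<bullet> ?q = (?a \<bullet> ?u) \<bullet> (?a \<bullet> ?u)"
        using sq b w3 a w neq cod.right_cancel[of ?u ?q w] by auto
      have "cod.inv ?a \<bullet> cod.T ?a ?q = cod.inv ?a \<bullet> w"
        using cod.T_mult[of ?a "cod.inv ?a" ?q] q1 T_b T_inv w2 a by simp
      then have "cod.T ?a ?q = w"
        using a w by simp
      then have "cod.T ?a ?u \<bullet> w = ?u \<bullet> w"
        using cod.T_mult[of ?a ?u ?q] q2 T_bb w4 a by simp
      then have "?a \<bullet> ?u = ?u \<bullet> ?a"
        using T_u a w by simp
      then have "cod.inv ?a \<bullet> ?q = cod.inv ?a \<bullet> w"
        using q1 w2 by simp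
      then show False
        using neq a w by simp
    qed
  next
    case False
    then have b: "f (x \<cdot> y) = ?u \<bullet> ?a"
      using f_mult Q by blast
    show ?thesis
    proof (rule ccontr)
      assume neq: "?q \<noteq> w"
      then have q1: "?q \<bullet> cod.inv ?a = ?u \<bullet> ?a"
        using calculation b w2 a w cod.left_cancel[of "cod.inv ?a" ?q w] by auto
      have q2: "?q \<bullet> ?u = (?u \<bullet> ?a) \<bullet> (?u \<bullet> ?a)"
        using sq b w4 a w neq cod.left_cancel[of ?u ?q w] by auto
      have "cod.T ?a w \<bullet> cod.inv ?a = ?q \<bullet> cod.inv ?a"
        using cod.T_mult[of ?a w "cod.inv ?a"] q1 T_b T_inv w1 a w by simp
      then have "cod.T ?a w = ?q"
        using a w by simp
      then have "?q \<bullet> cod.T ?a ?u = ?q \<bullet> ?u"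
        using cod.T_mult[of ?a w ?u] q2 T_bb w3 a w by simp
      then have "?a \<bullet> ?u = ?u \<bullet> ?a"
        using T_u a w by simp
      then have "?q \<bullet> cod.inv ?a = w \<bullet> cod.inv ?a"
        using q1 w1 by simp
      then show False
        using neq a w by simp
    qed
  qed
  then show "?q \<bullet> cod.inv ?a = ?a \<bullet> ?u" "cod.inv ?a \<bullet> ?q = ?u \<bullet> ?a"
    using w1 w2 by auto
qed

text \<open>In a group, the auxiliary \<open>z\<close> is x^{-2} y. Then \<open>y\<close> is the
  sandwich element of \<open>x\<close> and \<open>z\<close>, and \<open>x \<cdot> y\<close> that of
  \<open>x\<close> and \<open>x \<cdot> z\<close>, so the order chosen for
  \<open>f (x \<cdot> z)\<close> decides both values.\<close>

lemma f_mult_inv_commuting: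
  assumes Q: "x \<in> Q" "y \<in> Q" and comm: "x \<cdot> y = y \<cdot> x"
  shows "(f (x \<cdot> y) = f x \<bullet> f y \<and> f (dom.inv x \<cdot> y) = f y \<bullet> cod.inv (f x)) \<or>
    (f (x \<cdot> y) = f y \<bullet> f x \<and> f (dom.inv x \<cdot> y) = cod.inv (f x) \<bullet> f y)"
proof -
  let ?a = "f x" and ?u = "f y"
  define z where "z = dom.ldiv x (dom.inv x \<cdot> y)"
  have z: "z \<in> Q" "x \<cdot> z = dom.inv x \<cdot> y"
    using dom.ldiv[of x "dom.inv x \<cdot> y"] Q by (auto simp: z_def)
  have inv_comm: "y \<cdot> dom.inv x = dom.inv x \<cdot> y"
    using comm Q by (simp add: dom.commute_inv)
  have x_inv: "x \<cdot> dom.inv x = dom.inv x \<cdot> x"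
    using Q by simp
  have "x \<cdot> (dom.inv x \<cdot> y) = (dom.inv x \<cdot> y) \<cdot> x"
    using dom.commute_mult(1)[of x "dom.inv x" y] x_inv comm Q by simp
  then have xz: "x \<cdot> z = z \<cdot> x"
    using dom.commute_mult(1)[of x x z] z Q by simp
  let ?c = "f z"
  have c: "?a \<in> Q'" "?u \<in> Q'" "?c \<in> Q'"
    using Q z by auto
  have u: "?u \<bullet> cod.inv ?a = ?a \<bullet> ?c" "cod.inv ?a \<bullet> ?u = ?c \<bullet> ?a"
    using f_sandwich[of x z y] Q z xz inv_comm by auto
  have "(x \<cdot> y) \<cdot> dom.inv x = x \<cdot> (x \<cdot> z)"
    using dom.right_inv_left_commute[of x y] Q inv_comm z by simp
  moreover have "x \<cdot> (x \<cdot> z) = (x \<cdot> z) \<cdot> x"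
    using dom.commute_mult(1)[of x x z] xz z Q by simp
  ultimately have v: "f (x \<cdot> y) \<bullet> cod.inv ?a = ?a \<bullet> f (x \<cdot> z)"
    "cod.inv ?a \<bullet> f (x \<cdot> y) = f (x \<cdot> z) \<bullet> ?a"
    using f_sandwich[of x "x \<cdot> z" "x \<cdot> y"] Q z by auto
  consider "f (x \<cdot> z) = ?a \<bullet> ?c" | "f (x \<cdot> z) = ?c \<bullet> ?a"
    using f_mult Q z by blast
  then show ?thesis
  proof cases
    case 1
    then have "f (x \<cdot> y) \<bullet> cod.inv ?a = (?a \<bullet> ?u) \<bullet> cod.inv ?a"
      using v(1) u(1) c cod.right_inv_left_commute[of ?a ?u] by simp
    then show ?thesis
      using 1 u(1) z Q c by simp
  next
    case 2
    then have "cod.inv ?a \<bullet> f (x \<cdot> y) = cod.inv ?a \<bullet> (?u \<bullet> ?a)"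
      using v(2) u(2) c cod.left_inv_right_commute[of ?a ?u] by simp
    then show ?thesis
      using 2 u(2) z Q c by simp
  qed
qed

lemma f_commuting:
  assumes Q: "x \<in> Q" "y \<in> Q" and comm: "x \<cdot> y = y \<cdot> x"
  shows "f x \<bullet> f y = f y \<bullet> f x"
proof (rule ccontr)
  let ?a = "f x" and ?u = "f y"
  assume neq: "?a \<bullet> ?u \<noteq> ?u \<bullet> ?a"
  have c: "?a \<in> Q'" "?u \<in> Q'"
    using Q by auto
  have inv_comm: "y \<cdot> dom.inv x = dom.inv x \<cdot> y"
    using comm Q by (simp add: dom.commute_inv)
  have neq': "?u \<bullet> cod.inv ?a \<noteq> cod.inv ?a \<bullet> ?u"
    using neq c by (metis cod.commute_inv)
  have neq'': "cod.inv ?u \<bullet> cod.inv ?a \<noteq> cod.inv ?a \<bullet> cod.inv ?u"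
    using neq' c cod.commute_inv[of "cod.inv ?a" ?u] by auto
  have inv: "f (dom.inv y \<cdot> dom.inv x) = cod.inv (f (x \<cdot> y))"
    using dom.inv_mult[of x y] f_inv[of "x \<cdot> y"] Q by simp
  \<comment> \<open>The first fact ties the order in \<open>f (x \<cdot> y)\<close> to that in
    \<open>f (dom.inv x \<cdot> y)\<close>, the second ties the latter to that in
    \<open>f (dom.inv y \<cdot> dom.inv x)\<close>. The outcome is the opposite of what
    \<open>inv\<close> prescribes.\<close>
  from f_mult_inv_commuting[OF Q comm]
    f_mult_inv_commuting[of y "dom.inv x", OF _ _ inv_comm]
  show False
    using Q c inv inv_comm neq' neq'' by (auto simp: f_inv cod.inv_mult)
qed

lemma commute_iff:
  assumes "x \<in> Q" "y \<in> Q"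
  shows "x \<cdot> y = y \<cdot> x \<longleftrightarrow> f x \<bullet> f y = f y \<bullet> f x"
  using assms f_commuting f_mult[of x y] f_mult[of y x] by (metis dom.closed f_inj)

section \<open>Pairs whose product is preserved and pairs whose product is reversed\<close>

definition iso_at :: "'a \<Rightarrow> 'a \<Rightarrow> bool" where
  "iso_at x y \<longleftrightarrow> x \<in> Q \<and> y \<in> Q \<and> x \<cdot> y \<noteq> y \<cdot> x \<and> f (x \<cdot> y) = f x \<bullet> f y"

text \<open>Requiring noncommutation makes this incompatible with \<open>iso_at\<close> for the same
  pair, by \<open>commute_iff\<close>.\<close>

definition anti_at :: "'a \<Rightarrow> 'a \<Rightarrow> bool" where
  "anti_at x y \<longleftrightarrow> x \<in> Q \<and> y \<in> Q \<and> x \<cdot> y \<noteq> y \<cdot> x \<and> f (x \<cdot> y) = f y \<bullet> f x"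

lemma iso_or_anti_at:
  "x \<in> Q \<Longrightarrow> y \<in> Q \<Longrightarrow> x \<cdot> y \<noteq> y \<cdot> x \<Longrightarrow> iso_at x y \<or> anti_at x y"
  using f_mult by (auto simp: iso_at_def anti_at_def)

lemma iso_at_sym: "iso_at x y \<Longrightarrow> iso_at y x"
  unfolding iso_at_def using f_mult[of y x] by (metis dom.closed f_inj)

lemma anti_at_sym: "anti_at x y \<Longrightarrow> anti_at y x"
  unfolding anti_at_def using f_mult[of y x] by (metis dom.closed f_inj)

text \<open>Since \<open>x \<cdot> dom.T x y = y \<cdot> x\<close>, the image of this product is
  known by symmetry; the reversed order would force \<open>dom.T x y = y\<close>.\<close>

lemma iso_at_T:
  assumes "iso_at x y"
  shows "f (dom.T x y) = cod.T (f x) (f y)" "iso_at x (dom.T x y)"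
proof -
  let ?y = "dom.T x y"
  have Q: "x \<in> Q" "y \<in> Q" "?y \<in> Q" and neq: "x \<cdot> y \<noteq> y \<cdot> x"
    using assms by (auto simp: iso_at_def)
  have c: "f x \<in> Q'" "f y \<in> Q'" "f ?y \<in> Q'"
    using Q by auto
  have T: "x \<cdot> ?y = y \<cdot> x"
    using dom.mult_T Q by simp
  have yx: "f (x \<cdot> ?y) = f y \<bullet> f x"
    using iso_at_sym[OF assms] T by (simp add: iso_at_def)
  have "?y \<noteq> y"
    using T neq by auto
  then have "f ?y \<bullet> f x \<noteq> f y \<bullet> f x"
    using c Q by simp
  then have *: "f x \<bullet> f ?y = f y \<bullet> f x"
    using f_mult[of x ?y] yx Q by auto
  then show "f ?y = cod.T (f x) (f y)"
    using c cod.T_eq_iff by metis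
  have "x \<cdot> ?y \<noteq> ?y \<cdot> x"
    using neq Q dom.commute_iff_T dom.T_inj by simp
  then show "iso_at x ?y"
    using Q yx * by (simp add: iso_at_def)
qed

text \<open>Same argument as for \<open>iso_at_T\<close>, but here \<open>f\<close> turns
  \<open>dom.T x\<close> into the inverse of \<open>cod.T (f x)\<close>.\<close>

lemma anti_at_T:
  assumes "anti_at x y"
  shows "cod.T (f x) (f (dom.T x y)) = f y" "anti_at x (dom.T x y)"
proof -
  let ?y = "dom.T x y"
  have Q: "x \<in> Q" "y \<in> Q" "?y \<in> Q" and neq: "x \<cdot> y \<noteq> y \<cdot> x"
    using assms by (auto simp: anti_at_def)
  have c: "f x \<in> Q'" "f y \<in> Q'" "f ?y \<in> Q'"
    using Q by auto
  have T: "x \<cdot> ?y = y \<cdot> x"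
    using dom.mult_T Q by simp
  have yx: "f (x \<cdot> ?y) = f x \<bullet> f y"
    using anti_at_sym[OF assms] T by (simp add: anti_at_def)
  have "?y \<noteq> y"
    using T neq by auto
  then have "f x \<bullet> f ?y \<noteq> f x \<bullet> f y"
    using c Q by simp
  then have *: "f ?y \<bullet> f x = f x \<bullet> f y"
    using f_mult[of x ?y] yx Q by auto
  then show "cod.T (f x) (f ?y) = f y"
    using c by (simp add: cod.T_eq_iff)
  have "x \<cdot> ?y \<noteq> ?y \<cdot> x"
    using neq Q dom.commute_iff_T dom.T_inj by simp
  then show "anti_at x ?y"
    using Q yx * by (simp add: anti_at_def)
qed

lemma T_cases:
  assumes "x \<in> Q" "q \<in> Q"
  shows "f (dom.T x q) = cod.T (f x) (f q) \<or> cod.T (f x) (f (dom.T x q)) = f q"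
proof (cases "x \<cdot> q = q \<cdot> x")
  case True
  moreover from this have "f x \<bullet> f q = f q \<bullet> f x"
    using f_commuting assms by simp
  ultimately show ?thesis
    using assms by (simp add: dom.commute_iff_T cod.commute_iff_T)
next
  case False
  then show ?thesis
    using iso_or_anti_at[OF assms] iso_at_T anti_at_T by metis
qed

text \<open>Otherwise \<open>cod.T (f x)\<close> would have to move the image of
  \<open>dom.inv y\<close> both forwards and backwards to the same element, so its square would fix
  that image.\<close>

lemma iso_at_inv:
  assumes C: "condC Q' (\<bullet>)" and y: "iso_at x y"
  shows "iso_at x (dom.inv y)"
proof (rule ccontr)
  have Q: "x \<in> Q" "y \<in> Q" and neq: "x \<cdot> dom.inv y \<noteq> dom.inv y \<cdot> x"
    using y dom.commute_inv by (auto simp: iso_at_def)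
  let ?u = "cod.inv (f y)"
  have c: "f x \<in> Q'" "?u \<in> Q'"
    using Q by auto
  have T: "f (dom.T x (dom.inv y)) = cod.T (f x) ?u"
    using iso_at_T(1)[OF y] Q by (simp add: dom.T_inv cod.T_inv f_inv)
  assume "\<not> ?thesis"
  then have "anti_at x (dom.inv y)"
    using iso_or_anti_at[of x "dom.inv y"] Q neq by auto
  from anti_at_T(1)[OF this] have "cod.T (f x) (cod.T (f x) ?u) = ?u"
    using T Q by (simp add: f_inv)
  then show False
    using cod.T_square_fixed[OF C c] neq commute_iff[of x "dom.inv y"] c Q
    by (simp add: cod.commute_iff_T f_inv)
qed

section \<open>Excluding both kinds of pairs at a common element\<close>

text \<open>
  In the next lemma \<open>n\<close> is the product of the codomain or its opposite; \<open>u\<close> and \<open>v\<close> are the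
  images of \<open>y\<close> and \<open>z\<close>, and \<open>u\<^sub>k\<close>, \<open>v\<^sub>k\<close> those of \<open>T\<^sub>x\<^sup>k y\<close>, \<open>T\<^sub>x\<^sup>k z\<close>, so that \<open>T\<close> moves the
  \<open>u\<^sub>k\<close> forwards and the \<open>v\<^sub>k\<close> backwards.
\<close>

lemma opposite_orbits_product:
  assumes C: "condC Q' (\<bullet>)" and a: "a \<in> Q'" and T: "T = cod.T a"
    and n: "n = (\<bullet>) \<or> n = (\<lambda>x y. y \<bullet> x)"
    and u: "u \<in> Q'" "T u \<noteq> u" "u1 = T u" "u2 = T u1"
    and v: "v2 \<in> Q'" "T v2 \<noteq> v2" "v1 = T v2" "v = T v1"
    and p: "p = n u1 v1 \<or> p = n v1 u1" "p = T (n u v) \<or> T p = n u v"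
  shows "n v2 u = n u v \<or> n v u2 = n u v"
proof -
  have Q': "u1 \<in> Q'" "u2 \<in> Q'" "v1 \<in> Q'" "v \<in> Q'" "T v \<in> Q'"
    using a u v by (auto simp: T)
  have n_closed: "n x y \<in> Q'" and T_n: "T (n x y) = n (T x) (T y)"
    and n_left: "n z x = n z y \<longleftrightarrow> x = y" and n_right: "n x z = n y z \<longleftrightarrow> x = y"
    if "x \<in> Q'" "y \<in> Q'" "z \<in> Q'" for x y z
    using n that a by (auto simp: T cod.T_mult)
  have T_inj: "T x = T y \<longleftrightarrow> x = y" if "x \<in> Q'" "y \<in> Q'" for x y
    using that a by (simp add: T cod.T_inj)
  have u2: "u2 \<noteq> u"
    using cod.T_square_fixed[OF C a] u by (auto simp: T)
  have v2: "v \<noteq> v2"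
    using cod.T_square_fixed[OF C a] v by (auto simp: T)
  from p(2) show ?thesis
  proof
    assume "p = T (n u v)"
    then have *: "p = n u1 (T v)"
      using T_n u v Q' by simp
    \<comment> \<open>This rules out \<open>p = n u1 v1\<close>; the other order is an equation
      between two values of \<open>T\<close>, which can be pulled back.\<close>
    have "T v \<noteq> v1"
      using v2 T_inj v Q' by simp
    then have "n v1 u1 = n u1 (T v)"
      using * p(1) n_left Q' by auto
    then have "T (n v2 u) = T (n u v)"
      using T_n u v Q' by simp
    then show ?thesis
      using T_inj n_closed u v Q' by simp
  next
    assume *: "T p = n u v"
    \<comment> \<open>The first value differs from \<open>n u v\<close> because
      \<open>u2 \<noteq> u\<close>, so \<open>p\<close> is the second product.\<close>
    have "T (n u1 v1) = n u2 v" "T (n v1 u1) = n v u2"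
      using T_n u v Q' by simp_all
    then show ?thesis
      using * p(1) n_right u2 u Q' by auto
  qed
qed

lemma iso_anti_at_cases:
  assumes C: "condC Q' (\<bullet>)" and y: "iso_at x y" and z: "anti_at x z"
    and u: "u = f y" "u2 = f (dom.T x (dom.T x y))"
    and v: "v = f z" "v2 = f (dom.T x (dom.T x z))"
  shows "(v2 \<bullet> u = u \<bullet> v \<and> u2 \<bullet> v = v \<bullet> u) \<or> (u \<bullet> v2 = v \<bullet> u \<and> v \<bullet> u2 = u \<bullet> v)"
proof -
  let ?T = "dom.T x" and ?S = "cod.T (f x)"
  have Q: "x \<in> Q" "y \<in> Q" "z \<in> Q"
    using y z by (auto simp: iso_at_def anti_at_def)
  have c: "f x \<in> Q'" "u \<in> Q'" "v \<in> Q'" "u2 \<in> Q'" "v2 \<in> Q'"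
    using Q u v by auto
  have zz: "anti_at x (?T (?T z))"
    using anti_at_T z by blast
  have us: "?S u \<noteq> u" "f (?T y) = ?S u" "u2 = ?S (f (?T y))"
    using y iso_at_T[OF y] iso_at_T[of x "?T y"] commute_iff c u
    by (auto simp: iso_at_def cod.commute_iff_T)
  have vs: "?S v2 \<noteq> v2" "f (?T z) = ?S v2" "v = ?S (f (?T z))"
    using zz anti_at_T[OF z] anti_at_T[of x "?T z"] commute_iff c v
    by (auto simp: anti_at_def cod.commute_iff_T)
  have T: "f (?T q) = f (?T y) \<bullet> f (?T z) \<or> f (?T q) = f (?T z) \<bullet> f (?T y)"
    if "q = y \<cdot> z \<or> q = z \<cdot> y" for q
    using that f_mult[of "?T y" "?T z"] f_mult[of "?T z" "?T y"] Q by (auto simp: dom.T_mult)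
  have "f (y \<cdot> z) = u \<bullet> v \<and> f (z \<cdot> y) = v \<bullet> u \<or> f (y \<cdot> z) = v \<bullet> u \<and> f (z \<cdot> y) = u \<bullet> v"
    using f_mult[of y z] f_mult[of z y] commute_iff[of y z] f_inj[of "y \<cdot> z" "z \<cdot> y"] Q u v
    by (metis dom.closed)
  \<comment> \<open>Naming the two products by their images spares a case split on how
    \<open>f\<close> treats \<open>y\<close> and \<open>z\<close>.\<close>
  then obtain q r where q: "q = y \<cdot> z \<or> q = z \<cdot> y" "f q = u \<bullet> v"
    and r: "r = y \<cdot> z \<or> r = z \<cdot> y" "f r = v \<bullet> u"
    by blast
  have qr: "q \<in> Q" "r \<in> Q"
    using q r Q by auto
  have "v2 \<bullet> u = u \<bullet> v \<or> v \<bullet> u2 = u \<bullet> v"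
    using opposite_orbits_product[OF C c(1) refl, of "(\<bullet>)", OF _ c(2) us c(5) vs T[OF q(1)]]
      T_cases[OF Q(1) qr(1)] q(2) by simp
  \<comment> \<open>The same lemma for the opposite product, in which \<open>v \<bullet> u\<close>
    is the product of \<open>u\<close> and \<open>v\<close> in this order.\<close>
  moreover have "u \<bullet> v2 = v \<bullet> u \<or> u2 \<bullet> v = v \<bullet> u"
    using opposite_orbits_product[OF C c(1) refl, of "\<lambda>x y. y \<bullet> x", OF _ c(2) us c(5) vs,
        of "f (?T r)"] T[OF r(1)] T_cases[OF Q(1) qr(2)] r(2) by auto
  moreover have "\<not> (v2 \<bullet> u = u \<bullet> v \<and> u \<bullet> v2 = v \<bullet> u)"
    using cod.T_swap[OF C c(2,3,5)] cod.T_square_fixed[OF C c(1,5)] vs by auto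
  moreover have "\<not> (v \<bullet> u2 = u \<bullet> v \<and> u2 \<bullet> v = v \<bullet> u)"
    using cod.T_swap[OF C c(3,2,4)] cod.T_square_fixed[OF C c(1,2)] us by auto
  ultimately show ?thesis
    by blast
qed

text \<open>The alternatives for \<open>y\<close> are compared with those for
  \<open>dom.inv y\<close>, translated back into equations in \<open>u\<close>, \<open>v\<close>,
  \<open>u2\<close>, \<open>v2\<close>. In each of the four combinations \<open>cod.T u\<close>
  interchanges \<open>v\<close> and \<open>v2\<close>, or \<open>cod.T v\<close> interchanges
  \<open>u\<close> and \<open>u2\<close>.\<close>

lemma not_iso_and_anti_at:
  assumes C: "condC Q' (\<bullet>)" and y: "iso_at x y" and z: "anti_at x z"
  shows False
proof -
  let ?T = "dom.T x" and ?S = "cod.T (f x)"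
  define u u2 where "u = f y" and "u2 = f (?T (?T y))"
  define v v2 where "v = f z" and "v2 = f (?T (?T z))"
  have Q: "x \<in> Q" "y \<in> Q" "z \<in> Q"
    using y z by (auto simp: iso_at_def anti_at_def)
  have c: "f x \<in> Q'" "u \<in> Q'" "v \<in> Q'" "u2 \<in> Q'" "v2 \<in> Q'"
    using Q by (auto simp: u_def v_def u2_def v2_def)
  have us: "u2 = ?S (?S u)" "?S u \<noteq> u"
    using y iso_at_T[OF y] iso_at_T[of x "?T y"] commute_iff c
    by (auto simp: iso_at_def cod.commute_iff_T u_def u2_def)
  have "anti_at x (?T (?T z))"
    using anti_at_T z by blast
  then have vs: "v = ?S (?S v2)" "?S v2 \<noteq> v2"
    using anti_at_T[OF z] anti_at_T[of x "?T z"] commute_iff c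
    by (auto simp: anti_at_def cod.commute_iff_T v_def v2_def)
  have neq: "u \<noteq> u2" "v \<noteq> v2"
    using cod.T_square_fixed[OF C c(1)] c us vs by auto
  note cases = iso_anti_at_cases[OF C y z u_def u2_def v_def v2_def]
    iso_anti_at_cases[OF C iso_at_inv[OF C y] z refl refl v_def v2_def]
  have "f (dom.inv y) = cod.inv u" "f (?T (?T (dom.inv y))) = cod.inv u2"
    using Q by (simp_all add: u_def u2_def dom.T_inv f_inv)
  moreover have "v2 \<bullet> cod.inv u = cod.inv u \<bullet> v \<longleftrightarrow> u \<bullet> v2 = v \<bullet> u"
    "cod.inv u \<bullet> v2 = v \<bullet> cod.inv u \<longleftrightarrow> u \<bullet> v = v2 \<bullet> u"
    using cod.T_inverse_element c by metis+
  moreover have "v \<bullet> cod.inv u2 = cod.inv u \<bullet> v \<longleftrightarrow> v \<bullet> u2 = u \<bullet> v"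
    "cod.inv u2 \<bullet> v = v \<bullet> cod.inv u \<longleftrightarrow> v \<bullet> u = u2 \<bullet> v"
    using cod.T_eq_iff[of v u u2] cod.T_eq_iff[of v "cod.inv u" "cod.inv u2"]
      cod.T_eq_iff[of v u2 u] cod.T_eq_iff[of v "cod.inv u2" "cod.inv u"] c
    by (auto simp: cod.T_inv cod.inv_eq_iff)
  moreover have "\<not> (v2 \<bullet> u = u \<bullet> v \<and> u \<bullet> v2 = v \<bullet> u)"
    using cod.T_swap[OF C c(2,3,5)] neq by auto
  moreover have "\<not> (v \<bullet> u2 = u \<bullet> v \<and> u2 \<bullet> v = v \<bullet> u)"
    using cod.T_swap[OF C c(3,2,4)] neq by auto
  ultimately show False
    using cases by auto
qed

theorem trivial_of_condC:
  assumes C: "condC Q' (\<bullet>)"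
  shows "loop_iso Q (\<cdot>) Q' (\<bullet>) f \<or> loop_anti_iso Q (\<cdot>) Q' (\<bullet>) f"
proof (rule ccontr)
  assume nontrivial: "\<not> ?thesis"
  have bij: "bij_betw f Q Q'"
    using half_iso by (simp add: half_iso_def)
  obtain x y where xy: "iso_at x y"
    using nontrivial bij f_mult commute_iff unfolding loop_anti_iso_def iso_at_def by metis
  obtain z w where zw: "anti_at z w"
    using nontrivial bij f_mult commute_iff unfolding loop_iso_def anti_at_def by metis
  \<comment> \<open>A noncommuting pair \<open>a\<close>, \<open>b\<close> would be of one kind,
    clashing with the given pair at \<open>a\<close> or at \<open>b\<close>.\<close>
  have cross: "a \<cdot> b = b \<cdot> a" if "iso_at a c" "anti_at b d" for a b c d
  proof (rule ccontr)
    assume neq: "a \<cdot> b \<noteq> b \<cdot> a"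
    have "iso_at a b \<or> anti_at a b"
      using that neq by (intro iso_or_anti_at) (auto simp: iso_at_def anti_at_def)
    then show False
      using that not_iso_and_anti_at[OF C] iso_at_sym by blast
  qed
  have Q: "x \<in> Q" "y \<in> Q" "z \<in> Q" "w \<in> Q"
    using xy zw by (auto simp: iso_at_def anti_at_def)
  have neq: "y \<cdot> x \<noteq> x \<cdot> y" "w \<cdot> z \<noteq> z \<cdot> w"
    using xy zw by (auto simp: iso_at_def anti_at_def)
  have yz: "y \<cdot> z = z \<cdot> y"
    using cross[OF iso_at_sym[OF xy] zw] .
  have wx: "w \<cdot> x = x \<cdot> w"
    using cross[OF xy anti_at_sym[OF zw]] by simp
  \<comment> \<open>The single element \<open>x \<cdot> z\<close> commutes neither with
    \<open>y\<close> nor with \<open>w\<close>. It thus lies in an iso pair with \<open>y\<close>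
    and in an anti pair with \<open>w\<close>, although both kinds cannot occur at one
    element.\<close>
  have y_xz: "y \<cdot> (x \<cdot> z) \<noteq> (x \<cdot> z) \<cdot> y"
    using dom.commute_mult(2)[OF Q(2,3,1) yz] neq by simp
  have w_xz: "w \<cdot> (x \<cdot> z) \<noteq> (x \<cdot> z) \<cdot> w"
    using dom.commute_mult(1)[OF Q(4,1,3) wx] neq by simp
  have "iso_at y (x \<cdot> z)"
    using iso_or_anti_at[of y "x \<cdot> z"] not_iso_and_anti_at[OF C iso_at_sym[OF xy]] Q y_xz by auto
  moreover have "anti_at w (x \<cdot> z)"
    using iso_or_anti_at[of w "x \<cdot> z"] not_iso_and_anti_at[OF C _ anti_at_sym[OF zw]] Q w_xz by auto
  ultimately show False
    using not_iso_and_anti_at[OF C] iso_at_sym anti_at_sym by blast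
qed

end

theorem theorem4p1:
  fixes Q :: "'a set" and m :: "'a \<Rightarrow> 'a \<Rightarrow> 'a" and e :: 'a
    and Q' :: "'b set" and m' :: "'b \<Rightarrow> 'b \<Rightarrow> 'b" and e' :: 'b
    and f :: "'a \<Rightarrow> 'b"
  assumes "automorphic_loop Q m e"
    and "automorphic_loop Q' m' e'"
    and "half_iso Q m Q' m' f"
    and "condC Q' m'"
  shows "loop_iso Q m Q' m' f \<or> loop_anti_iso Q m Q' m' f"
proof -
  interpret half_isomorphism Q m e Q' m' e' f
    using assms by unfold_locales
  show ?thesis
    using trivial_of_condC assms(4) .
qed

end
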